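(* Let $n\in\mathbb{N}$. Then $$t(1,9,9,9;n)=\begin{cases}16\sigma\!\left(\dfrac{2n+7}{9}\right) & \text{if } n\equiv1\pmod 9,\\[2pt] 0 & \text{if } n\equiv2,4,5,7,8\pmod 9,\\[2pt] \dfrac43\big(\sigma(2n+7)-c(2n+7)\big) & \text{if } n\equiv0\pmod 3.\end{cases}$$
   Context: $\mathbb{N}$ denotes the set of positive integers. For $a,b,c,d\in\mathbb{N}$ and an integer $m\ge0$, $t(a,b,c,d;m)$ is the number of $(x,y,z,w)\in\mathbb{Z}^4$ with $m = a\frac{x(x-1)}{2}+b\frac{y(y-1)}{2}+c\frac{z(z-1)}{2}+d\frac{w(w-1)}{2}$. $\sigma(m)$ is the sum of the positive divisors of $m$. The integers $c(m)$ ($m\ge1$) are defined by the power series identity $q\prod_{k=1}^\infty(1-q^{6k})^4=\sum_{m=1}^\infty c(m)q^m$ ($|q|<1$); equivalently $c(m)=\frac13\sum(-1)^a a$, summed over $(a,b)\in\mathbb{Z}^2$ with $4m=a^2+3b^2$, $a\equiv2\pmod3$, $b\equiv a+2\pmod 4$. *)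

theory Defs
  imports "HOL-Analysis.Analysis" "HOL-Computational_Algebra.Formal_Power_Series"
begin

(* x * (x - 1) is even, so the integer division is exact. *)
definition triangular :: "int \<Rightarrow> int" where
  "triangular x = x * (x - 1) div 2"

(* Only meant for positive a, b, c, d: then the set is finite (lemma finite_rep_set) and card
   is the true number of representations. *)
definition tri_reps :: "nat \<Rightarrow> nat \<Rightarrow> nat \<Rightarrow> nat \<Rightarrow> nat \<Rightarrow> nat" where
  "tri_reps a b c d m = card {(x, y, z, w). int m = int a * triangular x + int b * triangular y
                                             + int c * triangular z + int d * triangular w}"

(* Only meant for m > 0; the set of divisors of 0 is infinite. *)
definition divisor_sum :: "nat \<Rightarrow> nat" where
  "divisor_sum m = (\<Sum>d | d dvd m. d)"

(* The m-th coefficient of q * prod_{k >= 1} (1 - q^(6k))^4. The library product starts at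
   k = 0, hence Suc k; it is a limit of formal power series, which exists by
   has_prod_eta_factors. *)
definition c_coeff :: "nat \<Rightarrow> int" where
  "c_coeff m = fps_nth (fps_X * (\<Prod>k. (1 - fps_X ^ (6 * Suc k)) ^ 4)) m"

lemma has_prod_eta_factors:
  "(\<lambda>k. (1 - fps_X ^ (6 * Suc k)) ^ 4 :: int fps) has_prod (\<Prod>k. (1 - fps_X ^ (6 * Suc k)) ^ 4)"
proof -
  define f :: "nat \<Rightarrow> int fps" where "f = (\<lambda>k. (1 - fps_X ^ (6 * Suc k)) ^ 4)"
  define h :: "nat \<Rightarrow> int fps" where
    "h = (\<lambda>k. fps_X ^ (6 * Suc k) * (- 4 + 6 * fps_X ^ (6 * Suc k)
                 - 4 * (fps_X ^ (6 * Suc k)) ^ 2 + (fps_X ^ (6 * Suc k)) ^ 3))"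
  have "(1 - y) ^ 4 - 1 = y * (- 4 + 6 * y - 4 * y ^ 2 + y ^ 3)" for y :: "int fps"
    by algebra
  then have fh: "f k - 1 = h k" for k
    unfolding f_def h_def by blast
  have h0: "fps_nth (h k) n = 0" if "n < 6 * Suc k" for k n
    unfolding h_def using that by (simp only: fps_X_power_mult_nth if_True)
  have f0: "fps_nth (f k) 0 = 1" for k
    using h0[of 0 k] fh[of k] by (metis diff_eq_eq add_0 fps_one_nth fps_sub_nth zero_less_Suc
        mult_pos_pos zero_less_numeral)
  then have nz: "f k \<noteq> 0" for k
    by (metis fps_zero_nth zero_neq_one)
  have hnz: "h k \<noteq> 0" for k
  proof -
    have "fps_nth (h k) (6 * Suc k) = -4"
      by (simp add: h_def fps_X_power_mult_nth fps_numeral_nth del: mult_Suc_right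
          flip: power_mult)
    then show ?thesis by force
  qed
  have sub: "subdegree (f k - 1) > n" if "k > n" for n k
  proof -
    have "subdegree (h k) \<ge> 6 * Suc k"
      by (rule subdegree_geI[OF hnz h0])
    with that show ?thesis by (simp add: fh)
  qed
  obtain P where P: "(\<lambda>n. \<Prod>k\<le>n. f k) \<longlonglongrightarrow> P"
    using tendsto_prod_fps[of f "\<lambda>n. n", OF nz sub] by blast
  have "P \<noteq> 0"
  proof
    assume "P = 0"
    then have "eventually (\<lambda>n. fps_nth (\<Prod>k\<le>n. f k) 0 = 0) sequentially"
      using P by (auto simp: tendsto_fps_iff)
    moreover have "fps_nth (\<Prod>k\<le>n. f k) 0 = 1" for n
      by (induction n) (simp_all add: f0)
    ultimately show False by simp
  qed
  then have "f has_prod P"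
    using P by (simp add: has_prod_def raw_has_prod_def)
  then have "f has_prod prodinf f"
    using has_prod_unique by metis
  then show ?thesis unfolding f_def .
qed

lemma finite_rep_set:
  assumes "a > 0" "b > 0" "c > 0" "d > 0"
  shows "finite {(x, y, z, w). int m = int a * triangular x + int b * triangular y
                                       + int c * triangular z + int d * triangular w}"
proof -
  have ge: "triangular x \<ge> \<bar>x\<bar> - 1" for x
  proof -
    have "2 * (\<bar>x\<bar> - 1) \<le> x * (x - 1)"
    proof -
      consider "x \<ge> 2" | "x = 1" | "x = 0" | "x < 0" by linarith
      then show ?thesis
      proof cases
        case 1
        have "0 \<le> (x - 1) * (x - 2)" using 1 by simp
        then show ?thesis using 1 by (simp add: algebra_simps)
      next
        case 4
        have "0 \<le> (- x) * (- x - 1)" using 4 by (intro mult_nonneg_nonneg) auto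
        then show ?thesis using 4 by (simp add: algebra_simps)
      qed auto
    qed
    then show ?thesis unfolding triangular_def
      using zdiv_mono1[of "2 * (\<bar>x\<bar> - 1)" "x * (x - 1)" 2] by simp
  qed
  have ge0: "triangular x \<ge> 0" for x
  proof (cases "x = 0")
    case False
    then show ?thesis using ge[of x] by linarith
  qed (simp add: triangular_def)
  let ?I = "{- int m - 1..int m + 1}"
  have "x \<in> ?I" if "k > 0" "int k * triangular x \<le> int m" for x k
  proof -
    have "triangular x \<le> int k * triangular x"
      using that(1) ge0[of x] by (simp add: mult_le_cancel_right1)
    then show ?thesis using that(2) ge[of x] by auto
  qed
  moreover have "int k * triangular x \<ge> 0" for k x
    using ge0 by simp
  ultimately have "{(x, y, z, w). int m = int a * triangular x + int b * triangular y
        + int c * triangular z + int d * triangular w} \<subseteq> ?I \<times> ?I \<times> ?I \<times> ?I"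
    using assms by (smt (verit) case_prodE mem_Collect_eq mem_Sigma_iff subsetI)
  then show ?thesis
    by (rule finite_subset) auto
qed

end

theory Submission
  imports Defs
begin

text \<open>
  Put \<open>M = 2 n + 7\<close>. Completing squares, \<open>t(1,9,9,9;n)\<close> counts the odd solutions of
  \<open>x\<^sup>2 + 9 (y\<^sup>2 + z\<^sup>2 + w\<^sup>2) = 4 M\<close>. If \<open>3\<close> divides \<open>M\<close>, or \<open>M \<equiv> 2 (mod 3)\<close>, congruences modulo 9 reduce
  everything to Jacobi's theorem that \<open>4 M\<close> is a sum of four odd squares in \<open>16 \<sigma>(M)\<close> ways.

  Let \<open>M = 6 m + 1\<close>, and let \<open>V\<close> be the set of \<open>(a, b, c, d)\<close> for which the squares of
  \<open>6 a + 1, \<dots>, 6 d + 1\<close> sum to \<open>4 M\<close>; let \<open>E\<close> and \<open>O\<close> be the numbers of its elements with even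
  and odd \<open>a + b + c + d\<close>. In a representation of \<open>4 M\<close> by four odd squares, either one or all four of
  the variables are prime to 3, so \<open>16 \<sigma>(M) = 4 t + 16 (E + O)\<close>. Euler's pentagonal number theorem
  gives \<open>c(M) = E - O\<close>. Half the 4 by 4 Hadamard matrix maps the quadruple \<open>(6 a + 1, \<dots>)\<close>
  to \<open>(3 k + 2, 3 y, 3 z, 3 w)\<close>, where \<open>k = a + b + c + d\<close>; for odd \<open>k\<close> all entries are odd, and up to
  two signs every solution of the equation above arises once, so \<open>t = 4 O\<close>. Eliminating \<open>E\<close> and \<open>O\<close>
  gives \<open>3 t = 4 (\<sigma>(M) - c(M))\<close>.

  Jacobi's theorem follows from a recurrence: summing \<open>D - 5 h\<^sup>2\<close> over all representations of
  \<open>D = 4 M + 1\<close> as a sum of five odd squares, with \<open>h\<close> the first entry, gives 0 by symmetry.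
  The divisor sums satisfy the same recurrence; with \<open>D - h\<^sup>2 = 4 a c\<close> this is a statement about
  the solutions of \<open>b\<^sup>2 + 4 a c = D\<close>, proved by an involution in the style of Zagier.
\<close>

section \<open>Sums of four odd squares\<close>

text \<open>A triple stands for the indefinite binary form \<open>a X^2 + b X Y - c Y^2\<close> of
  discriminant \<open>D\<close>; recording minus the last coefficient keeps both \<open>a\<close>
  and \<open>c\<close> positive.\<close>

definition simple_forms :: "int \<Rightarrow> (int \<times> int \<times> int) set" where
  "simple_forms D = {(a, b, c). a > 0 \<and> c > 0 \<and> b\<^sup>2 + 4 * a * c = D}"

lemma abs_le_square_int: "\<bar>x\<bar> \<le> (x::int)\<^sup>2"
proof (cases "x = 0")
  case False
  then have "\<bar>x\<bar> * 1 \<le> \<bar>x\<bar> * \<bar>x\<bar>" by (intro mult_left_mono) auto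
  then show ?thesis by (simp add: power2_eq_square)
qed simp

lemma finite_simple_forms: "finite (simple_forms D)"
proof (rule finite_subset)
  show "simple_forms D \<subseteq> {1..D} \<times> {-D..D} \<times> {1..D}"
  proof
    fix q assume "q \<in> simple_forms D"
    then obtain a b c where q: "q = (a, b, c)" and
      *: "a > 0" "c > 0" "b\<^sup>2 + 4 * (a * c) = D"
      by (auto simp: simple_forms_def)
    then have "a * 1 \<le> a * c" "1 * c \<le> a * c"
      by (intro mult_left_mono mult_right_mono; simp)+
    moreover have "b\<^sup>2 \<ge> 0" "\<bar>b\<bar> \<le> b\<^sup>2" by (auto simp: abs_le_square_int)
    ultimately have "a \<le> D" "c \<le> D" "\<bar>b\<bar> \<le> D"
      using * by linarith+
    then show "q \<in> {1..D} \<times> {-D..D} \<times> {1..D}"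
      using q * by auto
  qed
qed auto

lemma sum_simple_forms_eq_0:
  assumes "\<And>x. x\<^sup>2 \<noteq> D"
  shows "(\<Sum>(a, b, c)\<in>simple_forms D. a * (a * c - b\<^sup>2)) = 0"
proof -
  let ?S = "simple_forms D"
  \<comment> \<open>\<open>?G\<close> is the symmetrised summand plus a term odd in \<open>b\<close>. It is invariant under the swap
    \<open>(a, b, c) \<mapsto> (c, -b, a)\<close> of \<open>S1\<close> and \<open>S2\<close>, and the involution \<open>T\<close> of \<open>S1\<close> changes its sign.\<close>
  define S1 where "S1 = {(a, b, c) \<in> ?S. c > a + b}"
  define S2 where "S2 = {(a, b, c) \<in> ?S. c < a + b}"
  define T :: "int \<times> int \<times> int \<Rightarrow> int \<times> int \<times> int"
    where "T = (\<lambda>(a, b, c). (a, - b - 2 * a, c - a - b))"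
  let ?G = "\<lambda>(a, b, c). (a + c) * (a + b) * (c - b :: int)"
  \<comment> \<open>The form takes the value \<open>a + b - c\<close> at (1, 1), which cannot be 0
    because the discriminant is not a square.\<close>
  have "c \<noteq> a + b" if "(a, b, c) \<in> ?S" for a b c
  proof
    assume "c = a + b"
    then have "(2 * a + b)\<^sup>2 = D"
      using that by (simp add: simple_forms_def power2_eq_square algebra_simps)
    then show False using assms by blast
  qed
  then have "c > a + b \<or> c < a + b" if "(a, b, c) \<in> ?S" for a b c
    using that by (meson linorder_neqE)
  then have S: "?S = S1 \<union> S2" "S1 \<inter> S2 = {}"
    by (auto simp: S1_def S2_def)
  have fin: "finite S1" "finite S2"
    using finite_simple_forms[of D] S(1) by auto
  have S12: "sum ?G S1 = sum ?G S2"
    by (rule sum.reindex_bij_witness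
          [where i = "\<lambda>(a, b, c). (c, -b, a)" and j = "\<lambda>(a, b, c). (c, -b, a)"])
       (auto simp: S1_def S2_def simple_forms_def algebra_simps)
  have "sum ?G S1 = (\<Sum>q\<in>S1. - ?G q)"
  proof -
    have "T q \<in> S1 \<and> T (T q) = q \<and> - ?G (T q) = ?G q" if "q \<in> S1" for q
    proof -
      obtain a b c where q: "q = (a, b, c)" and
        abc: "a > 0" "c > 0" "b\<^sup>2 + 4 * a * c = D" "c > a + b"
        using \<open>q \<in> S1\<close> by (auto simp: S1_def simple_forms_def)
      \<comment> \<open>\<open>T\<close> is the change of variables (X, Y) -> (X - Y, -Y), so it
        preserves the discriminant.\<close>
      have "(- b - 2 * a)\<^sup>2 + 4 * a * (c - a - b) = D"
        unfolding abc(3)[symmetric] by algebra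
      moreover have "- ((a + (c - a - b)) * (a + (- b - 2 * a)) * (c - a - b - (- b - 2 * a)))
          = (a + c) * (a + b) * (c - b)"
        by algebra
      ultimately show ?thesis
        using abc by (simp add: q T_def S1_def simple_forms_def)
    qed
    then show ?thesis
      by (intro sum.reindex_bij_witness[where i = T and j = T]) auto
  qed
  then have "sum ?G S1 = 0" by (simp add: sum_negf)
  then have G: "sum ?G ?S = 0"
    using S12 S fin by (simp add: sum.union_disjoint)
  let ?g = "\<lambda>(a, b, c). a * (a * c - b\<^sup>2) :: int"
  have "sum ?g ?S = (\<Sum>(a, b, c)\<in>?S. c * (a * c - b\<^sup>2))"
    by (rule sum.reindex_bij_witness
          [where i = "\<lambda>(a, b, c). (c, b, a)" and j = "\<lambda>(a, b, c). (c, b, a)"])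
       (auto simp: simple_forms_def algebra_simps)
  then have "2 * sum ?g ?S = (\<Sum>q\<in>?S. ?g q + (case q of (a, b, c) \<Rightarrow> c * (a * c - b\<^sup>2)))"
    by (simp add: sum.distrib)
  also have "\<dots> = (\<Sum>q\<in>?S. ?G q + (case q of (a, b, c) \<Rightarrow> b * (a\<^sup>2 - c\<^sup>2)))"
    by (intro sum.cong refl) (auto simp: power2_eq_square algebra_simps)
  also have "\<dots> = (\<Sum>(a, b, c)\<in>?S. b * (a\<^sup>2 - c\<^sup>2))"
    using G by (simp add: sum.distrib)
  also have "\<dots> = 0"
  proof -
    have "(\<Sum>(a, b, c)\<in>?S. b * (a\<^sup>2 - c\<^sup>2)) = (\<Sum>q\<in>?S. - (case q of (a, b, c) \<Rightarrow> b * (a\<^sup>2 - c\<^sup>2)))"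
      by (rule sum.reindex_bij_witness
            [where i = "\<lambda>(a, b, c). (a, -b, c)" and j = "\<lambda>(a, b, c). (a, -b, c)"])
         (auto simp: simple_forms_def algebra_simps)
    then show ?thesis by (simp add: sum_negf)
  qed
  finally show ?thesis by simp
qed

lemma odd_square_mod_8: "odd x \<Longrightarrow> x\<^sup>2 mod 8 = (1::int)"
proof -
  assume "odd x"
  then have "x mod 8 = 1 \<or> x mod 8 = 3 \<or> x mod 8 = 5 \<or> x mod 8 = 7" by presburger
  then show ?thesis by (auto simp: power_mod[of x 8 2, symmetric])
qed

lemma not_square_mod_8: "(D::int) mod 8 = 5 \<Longrightarrow> x\<^sup>2 \<noteq> D"
proof
  assume *: "D mod 8 = 5" "x\<^sup>2 = D"
  then have "odd D" by presburger
  then have "odd x" using * by auto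
  then show False using odd_square_mod_8[of x] * by simp
qed

lemma finite_squares_less: "finite {h::int. P h \<and> h\<^sup>2 < D}"
proof (rule finite_subset)
  show "{h::int. P h \<and> h\<^sup>2 < D} \<subseteq> {-D..D}"
  proof
    fix h assume "h \<in> {h::int. P h \<and> h\<^sup>2 < D}"
    then show "h \<in> {-D..D}" using abs_le_square_int[of h] by auto
  qed
qed auto

text \<open>The divisors \<open>a\<close> of \<open>(D - h\<^sup>2) div 4\<close> are the first
  entries of the forms with \<open>b = h\<close>, and
  \<open>D - 5 * h\<^sup>2 = 4 * (a * c - b\<^sup>2)\<close>; so the sum is 4 times the vanishing
  one over \<open>simple_forms D\<close>. As \<open>M\<close> is odd, \<open>D\<close> is 5 modulo 8
  and hence not a square.\<close>

lemma sum_divisor_sum_recurrence: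
  fixes M :: nat
  assumes "odd M"
  defines "D \<equiv> 4 * int M + 1"
  shows "(\<Sum>h | odd h \<and> h\<^sup>2 < D. (D - 5 * h\<^sup>2) * int (divisor_sum (nat ((D - h\<^sup>2) div 4)))) = 0"
proof -
  let ?H = "{h::int. odd h \<and> h\<^sup>2 < D}"
  let ?m = "\<lambda>h. nat ((D - h\<^sup>2) div 4)"
  have D8: "D mod 8 = 5"
  proof -
    obtain k where "M = 2 * k + 1" using assms(1) by (elim oddE)
    then show ?thesis by (simp add: D_def)
  qed
  have m: "int (?m h) * 4 = D - h\<^sup>2" "?m h > 0" if "h \<in> ?H" for h
  proof -
    have "h\<^sup>2 mod 8 = 1" "h\<^sup>2 < D" using that odd_square_mod_8 by auto
    then have "(D - h\<^sup>2) mod 4 = 0" "D - h\<^sup>2 > 0" using D8 by presburger+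
    then have "(D - h\<^sup>2) div 4 * 4 = D - h\<^sup>2" "(D - h\<^sup>2) div 4 > 0" by presburger+
    then show "int (?m h) * 4 = D - h\<^sup>2" "?m h > 0" by simp_all
  qed
  have "0 = 4 * (\<Sum>(a, b, c)\<in>simple_forms D. a * (a * c - b\<^sup>2))"
    using sum_simple_forms_eq_0[of D] not_square_mod_8[OF D8] by simp
  also have "\<dots> = (\<Sum>(a, b, c)\<in>simple_forms D. 4 * (a * (a * c - b\<^sup>2)))"
    by (simp add: sum_distrib_left case_prod_unfold)
  also have "\<dots> = (\<Sum>(h, d)\<in>Sigma ?H (\<lambda>h. {d. d dvd ?m h}). (D - 5 * h\<^sup>2) * int d)"
  proof (rule sum.reindex_bij_witness
      [where i = "\<lambda>(h, d). (int d, h, int (?m h) div int d)" and j = "\<lambda>(a, b, c). (b, nat a)"])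
    fix q assume "q \<in> simple_forms D"
    then obtain a b c where q: "q = (a, b, c)" and abc: "a > 0" "c > 0" "b\<^sup>2 + 4 * a * c = D"
      by (auto simp: simple_forms_def)
    have "odd D" using D8 by presburger
    then have "odd b" using abc(3) by auto
    moreover have "a * c > 0" using abc by simp
    ultimately have b: "b \<in> ?H" using abc(3) by (simp add: algebra_simps)
    have mb: "int (?m b) = a * c" using m(1)[OF b] abc(3) by (simp add: algebra_simps)
    then have "int (nat a) dvd int (?m b)" using abc by simp
    then have "nat a dvd ?m b" by (simp only: int_dvd_int_iff)
    then show "(case q of (a, b, c) \<Rightarrow> (b, nat a)) \<in> Sigma ?H (\<lambda>h. {d. d dvd ?m h})"
      using b q by auto
    show "(case case q of (a, b, c) \<Rightarrow> (b, nat a) of (h, d) \<Rightarrow> (int d, h, int (?m h) div int d)) = q"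
      using q mb abc by simp
    show "(case case q of (a, b, c) \<Rightarrow> (b, nat a) of (h, d) \<Rightarrow> (D - 5 * h\<^sup>2) * int d) =
          (case q of (a, b, c) \<Rightarrow> 4 * (a * (a * c - b\<^sup>2)))"
      using q abc by (simp flip: abc(3) add: algebra_simps)
  next
    fix r assume "r \<in> Sigma ?H (\<lambda>h. {d. d dvd ?m h})"
    then obtain h d where r: "r = (h, d)" "h \<in> ?H" "d dvd ?m h" by auto
    then obtain e where e: "?m h = d * e" by (elim dvdE)
    have de: "d > 0" "e > 0" using m(2)[OF r(2)] e by auto
    have "int (?m h) div int d = int e" using e de by simp
    moreover have "h\<^sup>2 + 4 * int d * int e = D" using m(1)[OF r(2)] e by simp
    ultimately show "(case r of (h, d) \<Rightarrow> (int d, h, int (?m h) div int d)) \<in> simple_forms D"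
      using r de by (simp add: simple_forms_def)
    show "(case case r of (h, d) \<Rightarrow> (int d, h, int (?m h) div int d) of (a, b, c) \<Rightarrow> (b, nat a)) = r"
      using r by simp
  qed
  also have "\<dots> = (\<Sum>h\<in>?H. \<Sum>d | d dvd ?m h. (D - 5 * h\<^sup>2) * int d)"
    using m(2) by (intro sum.Sigma[symmetric] ballI finite_squares_less) auto
  also have "\<dots> = (\<Sum>h\<in>?H. (D - 5 * h\<^sup>2) * int (divisor_sum (?m h)))"
    by (simp add: divisor_sum_def sum_distrib_left)
  finally show ?thesis by simp
qed

section \<open>Jacobi's theorem on four odd squares\<close>

definition odd_quads :: "int \<Rightarrow> (int \<times> int \<times> int \<times> int) set" where
  "odd_quads N = {(x, y, z, w). odd x \<and> odd y \<and> odd z \<and> odd w \<and> x\<^sup>2 + y\<^sup>2 + z\<^sup>2 + w\<^sup>2 = N}"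

lemma sum_squares_bounds:
  assumes "x\<^sup>2 + y\<^sup>2 + z\<^sup>2 + w\<^sup>2 = (N::int)"
  shows "x \<in> {-N..N}" "y \<in> {-N..N}" "z \<in> {-N..N}" "w \<in> {-N..N}"
  using assms abs_le_square_int[of x] abs_le_square_int[of y] abs_le_square_int[of z]
    abs_le_square_int[of w] by auto

lemma finite_odd_quads: "finite (odd_quads N)"
proof (rule finite_subset)
  show "odd_quads N \<subseteq> {-N..N} \<times> {-N..N} \<times> {-N..N} \<times> {-N..N}"
  proof
    fix q assume "q \<in> odd_quads N"
    then obtain x y z w where "q = (x, y, z, w)" "x\<^sup>2 + y\<^sup>2 + z\<^sup>2 + w\<^sup>2 = N"
      by (auto simp: odd_quads_def)
    then show "q \<in> {-N..N} \<times> {-N..N} \<times> {-N..N} \<times> {-N..N}"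
      using sum_squares_bounds[of x y z w N] by (simp only: mem_Times_iff fst_conv snd_conv)
  qed
qed auto

text \<open>Sort the representations of \<open>D\<close> by five odd squares according to their
  first entry. Permuting entries shows that every position has the same sum of squares, namely one
  fifth of \<open>D\<close> times the number of representations.\<close>

lemma odd_quads_recurrence:
  assumes "D mod 8 = 5"
  shows "(\<Sum>h | odd h \<and> h\<^sup>2 < D. (D - 5 * h\<^sup>2) * int (card (odd_quads (D - h\<^sup>2)))) = 0"
proof -
  let ?H = "{h::int. odd h \<and> h\<^sup>2 < D}"
  let ?F = "{(v, x, y, z, w). odd v \<and> odd x \<and> odd y \<and> odd z \<and> odd w \<and>
             v\<^sup>2 + x\<^sup>2 + y\<^sup>2 + z\<^sup>2 + w\<^sup>2 = D}"
  have F: "?F = Sigma ?H (\<lambda>h. odd_quads (D - h\<^sup>2))"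
  proof (intro set_eqI iffI)
    fix q assume "q \<in> ?F"
    then obtain v x y z w where q: "q = (v, x, y, z, w)" and
      *: "odd v" "odd x" "odd y" "odd z" "odd w" "v\<^sup>2 + x\<^sup>2 + y\<^sup>2 + z\<^sup>2 + w\<^sup>2 = D" by auto
    then have "x\<^sup>2 > 0" "y\<^sup>2 \<ge> 0" "z\<^sup>2 \<ge> 0" "w\<^sup>2 \<ge> 0" by auto
    then have "v\<^sup>2 < D" using * by linarith
    then show "q \<in> Sigma ?H (\<lambda>h. odd_quads (D - h\<^sup>2))"
      using q * by (simp add: odd_quads_def algebra_simps)
  qed (auto simp: odd_quads_def)
  have "(\<Sum>(v, x, y, z, w)\<in>?F. v\<^sup>2) = (\<Sum>(v, x, y, z, w)\<in>?F. x\<^sup>2)"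
    by (rule sum.reindex_bij_witness[where i = "\<lambda>(v, x, y, z, w). (x, v, y, z, w)"
          and j = "\<lambda>(v, x, y, z, w). (x, v, y, z, w)"]) (auto simp: algebra_simps)
  moreover have "(\<Sum>(v, x, y, z, w)\<in>?F. v\<^sup>2) = (\<Sum>(v, x, y, z, w)\<in>?F. y\<^sup>2)"
    by (rule sum.reindex_bij_witness[where i = "\<lambda>(v, x, y, z, w). (y, x, v, z, w)"
          and j = "\<lambda>(v, x, y, z, w). (y, x, v, z, w)"]) (auto simp: algebra_simps)
  moreover have "(\<Sum>(v, x, y, z, w)\<in>?F. v\<^sup>2) = (\<Sum>(v, x, y, z, w)\<in>?F. z\<^sup>2)"
    by (rule sum.reindex_bij_witness[where i = "\<lambda>(v, x, y, z, w). (z, x, y, v, w)"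
          and j = "\<lambda>(v, x, y, z, w). (z, x, y, v, w)"]) (auto simp: algebra_simps)
  moreover have "(\<Sum>(v, x, y, z, w)\<in>?F. v\<^sup>2) = (\<Sum>(v, x, y, z, w)\<in>?F. w\<^sup>2)"
    by (rule sum.reindex_bij_witness[where i = "\<lambda>(v, x, y, z, w). (w, x, y, z, v)"
          and j = "\<lambda>(v, x, y, z, w). (w, x, y, z, v)"]) (auto simp: algebra_simps)
  moreover have "(\<Sum>(v, x, y, z, w)\<in>?F. v\<^sup>2) + (\<Sum>(v, x, y, z, w)\<in>?F. x\<^sup>2) +
      (\<Sum>(v, x, y, z, w)\<in>?F. y\<^sup>2) + (\<Sum>(v, x, y, z, w)\<in>?F. z\<^sup>2) + (\<Sum>(v, x, y, z, w)\<in>?F. w\<^sup>2)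
      = (\<Sum>q\<in>?F. D)"
    unfolding sum.distrib[symmetric]
    by (intro sum.cong refl) auto
  ultimately have "5 * (\<Sum>(v, x, y, z, w)\<in>?F. v\<^sup>2) = (\<Sum>q\<in>?F. D)" by linarith
  moreover have "(\<Sum>(v, q)\<in>?F. D - 5 * v\<^sup>2) = (\<Sum>q\<in>?F. D) - 5 * (\<Sum>(v, x, y, z, w)\<in>?F. v\<^sup>2)"
    by (simp add: sum_subtractf sum_distrib_left case_prod_unfold)
  ultimately have "0 = (\<Sum>(v, q)\<in>?F. D - 5 * v\<^sup>2)" by simp
  also have "\<dots> = (\<Sum>h\<in>?H. \<Sum>q\<in>odd_quads (D - h\<^sup>2). D - 5 * h\<^sup>2)"
    unfolding F by (intro sum.Sigma[symmetric] ballI finite_squares_less finite_odd_quads)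
  finally show ?thesis by (simp add: mult.commute)
qed

lemma odd_square_ge_1: "odd (x::int) \<Longrightarrow> x\<^sup>2 \<ge> 1"
  using abs_le_square_int[of x] by (cases "x = 0") auto

lemma odd_square_ge_9: "odd (h::int) \<Longrightarrow> h \<notin> {1, -1} \<Longrightarrow> h\<^sup>2 \<ge> 9"
proof -
  assume "odd h" "h \<notin> {1, -1}"
  then have "\<bar>h\<bar> \<ge> 3" by (cases "h = 0"; cases "h = 2"; cases "h = -2") auto
  then have "3 * 3 \<le> \<bar>h\<bar> * \<bar>h\<bar>" by (intro mult_mono) auto
  then show ?thesis by (simp add: power2_eq_square)
qed

text \<open>Both sides obey the same recurrence. In it \<open>h = 1\<close> and
  \<open>h = -1\<close> involve \<open>M\<close> itself, with coefficient
  \<open>D - 5 = 4 * (M - 1)\<close>, and every other \<open>h\<close> a smaller odd number. That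
  coefficient vanishes for \<open>M = 1\<close>, so this case is counted directly.\<close>

theorem card_odd_quads:
  "odd M \<Longrightarrow> card (odd_quads (4 * int M)) = 16 * divisor_sum M"
proof (induction M rule: less_induct)
  case (less M)
  show ?case
  proof (cases "M = 1")
    case True
    have "odd_quads 4 = {1, -1} \<times> {1, -1} \<times> {1, -1} \<times> {1, -1}" (is "?L = ?R")
    proof
      show "?L \<subseteq> ?R"
      proof
        fix q assume "q \<in> ?L"
        then obtain x y z w where q: "q = (x, y, z, w)" and
          *: "odd x" "odd y" "odd z" "odd w" "x\<^sup>2 + y\<^sup>2 + z\<^sup>2 + w\<^sup>2 = 4"
          by (auto simp: odd_quads_def)
        have "x\<^sup>2 \<ge> 1" "y\<^sup>2 \<ge> 1" "z\<^sup>2 \<ge> 1" "w\<^sup>2 \<ge> 1" using * odd_square_ge_1 by auto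
        then have "x\<^sup>2 < 9" "y\<^sup>2 < 9" "z\<^sup>2 < 9" "w\<^sup>2 < 9" using *(5) by linarith+
        then have "x \<in> {1, -1}" "y \<in> {1, -1}" "z \<in> {1, -1}" "w \<in> {1, -1}"
          using *(1-4) odd_square_ge_9 by (meson not_le)+
        then show "q \<in> ?R" using q by blast
      qed
    qed (auto simp: odd_quads_def)
    then show ?thesis using True by (simp add: card_cartesian_product divisor_sum_def)
  next
    case False
    define D where "D = 4 * int M + 1"
    let ?H = "{h::int. odd h \<and> h\<^sup>2 < D}"
    let ?f = "\<lambda>h. (D - 5 * h\<^sup>2) * (int (card (odd_quads (D - h\<^sup>2))) -
                  16 * int (divisor_sum (nat ((D - h\<^sup>2) div 4))))"
    obtain k where k: "M = 2 * k + 1" using less.prems by (elim oddE)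
    have D8: "D mod 8 = 5" using k by (simp add: D_def)
    have "sum ?f ?H = (\<Sum>h\<in>?H. (D - 5 * h\<^sup>2) * int (card (odd_quads (D - h\<^sup>2)))) -
        16 * (\<Sum>h\<in>?H. (D - 5 * h\<^sup>2) * int (divisor_sum (nat ((D - h\<^sup>2) div 4))))"
      by (simp add: algebra_simps sum_subtractf sum_distrib_left sum.distrib)
    also have "\<dots> = 0"
      using odd_quads_recurrence[OF D8] sum_divisor_sum_recurrence[OF less.prems]
      by (simp add: D_def)
    finally have "sum ?f ?H = 0" .
    moreover have "sum ?f ?H = sum ?f {1, -1}"
    proof (rule sum.mono_neutral_right)
      show "finite ?H" by (rule finite_squares_less)
      show "{1, -1} \<subseteq> ?H" using k by (auto simp: D_def)
      show "\<forall>h\<in>?H - {1, -1}. ?f h = 0"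
      proof
        fix h assume h: "h \<in> ?H - {1, -1}"
        define m where "m = nat ((D - h\<^sup>2) div 4)"
        have "h\<^sup>2 mod 8 = 1" "h\<^sup>2 < D" "h\<^sup>2 \<ge> 9"
          using h odd_square_mod_8 odd_square_ge_9 by auto
        then have "(D - h\<^sup>2) div 4 * 4 = D - h\<^sup>2" "(D - h\<^sup>2) div 4 > 0"
            "(D - h\<^sup>2) div 4 < int M" "odd ((D - h\<^sup>2) div 4)"
          using D8 by (presburger, presburger, simp add: D_def, presburger)
        then have "D - h\<^sup>2 = 4 * int m" "m < M" "odd m"
          by (auto simp: m_def even_nat_iff)
        then show "?f h = 0" using less.IH[of m] by (simp flip: m_def)
      qed
    qed
    moreover have "M > 1" using less.prems False by (cases M) auto
    ultimately show ?thesis by (simp add: D_def)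
  qed
qed

section \<open>The pentagonal number theorem\<close>

text \<open>This is (-1)^k for an integer \<open>k\<close> that may be negative.\<close>

definition parity_sign :: "int \<Rightarrow> 'a::comm_ring_1" where
  "parity_sign k = (if even k then 1 else -1)"

text \<open>These are twice the generalised pentagonal numbers; the bound makes \<open>nat\<close>
  harmless in the exponents below.\<close>

lemma pentagonal_exponent_nonneg: "k * (3 * k + 1) \<ge> (0::int)"
proof (cases "k \<ge> 0")
  case False
  then show ?thesis by (intro mult_nonpos_nonpos) auto
qed simp

text \<open>Shanks' finite form of the pentagonal number theorem. Taking \<open>q = r\<^sup>2\<close> avoids halving the exponents.\<close>

lemma shanks_identity:
  fixes r :: "'a::comm_ring_1"
  shows "(\<Sum>s\<le>n. (-1) ^ s * (\<Prod>k\<in>{Suc s..n}. 1 - r ^ (2 * k)) * r ^ (2 * s * n + s * (s + 1))) =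
         (\<Sum>k\<in>{- int n..int n}. parity_sign k * r ^ nat (k * (3 * k + 1)))"
proof (induction n)
  case 0
  then show ?case by (simp add: parity_sign_def)
next
  case (Suc n)
  define g where "g = (\<lambda>s. (-1) ^ s * (\<Prod>k\<in>{Suc s..n}. 1 - r ^ (2 * k)) * r ^ (2 * s * n + s * (s + 1)))"
  \<comment> \<open>Passing from \<open>n\<close> to \<open>Suc n\<close> changes the summand by
    \<open>h (Suc s) - h s\<close>, which telescopes. Here \<open>h 0\<close> contains the factor
    \<open>1 - r ^ 0\<close>, while \<open>h (Suc n)\<close> and the new last summand supply the
    indices \<open>- int (Suc n)\<close> and \<open>int (Suc n)\<close>.\<close>
  define h where "h = (\<lambda>s. (-1) ^ s * (\<Prod>k\<in>{s..n}. 1 - r ^ (2 * k)) * r ^ (2 * s * n + s * (s + 1)))"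
  let ?t = "\<lambda>s. (-1) ^ s * (\<Prod>k\<in>{Suc s..Suc n}. 1 - r ^ (2 * k)) * r ^ (2 * s * Suc n + s * (s + 1))"
  let ?p = "\<lambda>k. parity_sign k * r ^ nat (k * (3 * k + 1)) :: 'a"
  have t: "?t s = g s + (h (Suc s) - h s)" if "s \<le> n" for s
  proof -
    have "?t s = g s * (r ^ (2 * s) * (1 - r ^ (2 * Suc n)))"
    proof -
      have "(\<Prod>k\<in>{Suc s..Suc n}. 1 - r ^ (2 * k)) = (1 - r ^ (2 * Suc n)) * (\<Prod>k\<in>{Suc s..n}. 1 - r ^ (2 * k))"
        using that by (intro prod.nat_ivl_Suc') simp
      moreover have "r ^ (2 * s * Suc n + s * (s + 1)) = r ^ (2 * s * n + s * (s + 1)) * r ^ (2 * s)"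
        by (simp add: algebra_simps flip: power_add)
      ultimately show ?thesis unfolding g_def by (simp only: mult_ac)
    qed
    moreover have "h s = g s * (1 - r ^ (2 * s))"
      using that by (simp add: g_def h_def prod.atLeast_Suc_atMost algebra_simps)
    moreover have "h (Suc s) = - (g s * (r ^ (2 * s) * r ^ (2 * Suc n)))"
    proof -
      have "2 * Suc s * n + Suc s * (Suc s + 1) = (2 * s * n + s * (s + 1)) + (2 * s + 2 * Suc n)"
        by (simp add: algebra_simps)
      moreover have "h (Suc s) = - ((-1) ^ s * (\<Prod>k\<in>{Suc s..n}. 1 - r ^ (2 * k))
          * r ^ (2 * Suc s * n + Suc s * (Suc s + 1)))"
        unfolding h_def by simp
      ultimately show ?thesis
        unfolding g_def by (simp only: power_add mult.assoc)
    qed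
    ultimately show ?thesis by (simp add: algebra_simps)
  qed
  have "(\<Sum>s\<le>n. ?t s) = (\<Sum>s\<le>n. g s + (h (Suc s) - h s))"
    by (intro sum.cong refl t) simp
  then have "sum ?t {..Suc n} = ?t (Suc n) + (\<Sum>s\<le>n. g s + (h (Suc s) - h s))"
    unfolding sum.atMost_Suc by (simp only: add.commute)
  also have "\<dots> = ?t (Suc n) + ((\<Sum>s\<le>n. g s) + (h (Suc n) - h 0))"
    by (simp only: sum.distrib lessThan_Suc_atMost[symmetric] sum_lessThan_telescope)
  also have "(\<Sum>s\<le>n. g s) = sum ?p {- int n..int n}"
    using Suc.IH by (simp add: g_def)
  also have "h 0 = 0"
    by (simp add: h_def prod.atLeast_Suc_atMost)
  also have "?t (Suc n) = ?p (int (Suc n))"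
  proof -
    have "nat (int (Suc n) * (3 * int (Suc n) + 1)) = Suc n * (3 * Suc n + 1)"
    proof -
      have "int (Suc n) * (3 * int (Suc n) + 1) = int (Suc n * (3 * Suc n + 1))"
        by (simp add: algebra_simps)
      then show ?thesis by (simp only: nat_int)
    qed
    moreover have "2 * Suc n * Suc n + Suc n * (Suc n + 1) = Suc n * (3 * Suc n + 1)"
      by (simp add: algebra_simps)
    ultimately show ?thesis by (simp add: parity_sign_def del: mult_Suc mult_Suc_right)
  qed
  also have "h (Suc n) = ?p (- int (Suc n))"
  proof -
    have "- int (Suc n) * (3 * - int (Suc n) + 1) = int (2 * Suc n * n + Suc n * (Suc n + 1))"
      by (simp add: algebra_simps)
    then show ?thesis
      by (simp only: nat_int h_def) (simp add: parity_sign_def)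
  qed
  also have "?p (int (Suc n)) + (sum ?p {- int n..int n} + (?p (- int (Suc n)) - 0)) =
             sum ?p {- int (Suc n)..int (Suc n)}"
  proof -
    have "{- int (Suc n)..int (Suc n)} = insert (int (Suc n)) (insert (- int (Suc n)) {- int n..int n})"
      by auto
    then show ?thesis by (simp add: algebra_simps)
  qed
  finally show ?case .
qed

text \<open>In Shanks' sum the term \<open>s = 0\<close> is the product itself, and for
  \<open>s \<ge> 1\<close> the exponent \<open>2 * s * n + s * (s + 1)\<close> is at least
  \<open>2 * n + 2\<close>.\<close>

lemma euler_product_cong:
  fixes r :: "'a::comm_ring_1"
  shows "r ^ (2 * n + 2) dvd (\<Sum>k\<in>{- int n..int n}. parity_sign k * r ^ nat (k * (3 * k + 1)))
           - (\<Prod>k\<in>{1..n}. 1 - r ^ (2 * k))"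
proof -
  let ?t = "\<lambda>s. (-1) ^ s * (\<Prod>k\<in>{Suc s..n}. 1 - r ^ (2 * k)) * r ^ (2 * s * n + s * (s + 1))"
  have "r ^ (2 * n + 2) dvd ?t s" if "s \<in> {1..n}" for s
  proof -
    have "s > 0" using that by simp
    then obtain t where "s = Suc t" by (cases s) auto
    then have "2 * n + 2 \<le> 2 * s * n + s * (s + 1)" by (simp add: algebra_simps)
    then show ?thesis by (intro dvd_mult le_imp_power_dvd)
  qed
  then have "r ^ (2 * n + 2) dvd (\<Sum>s\<in>{1..n}. ?t s)" by (rule dvd_sum)
  moreover have "sum ?t {..n} = ?t 0 + sum ?t {1..n}"
    by (simp add: atMost_atLeast0 sum.atLeast_Suc_atMost)
  ultimately show ?thesis by (simp flip: shanks_identity)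
qed

text \<open>The entries index four generalised pentagonal numbers with sum \<open>m\<close>; the
  equation is doubled to avoid halves.\<close>

definition pent_quads :: "nat \<Rightarrow> (int \<times> int \<times> int \<times> int) set" where
  "pent_quads m = {(x, y, z, w). x * (3 * x + 1) + y * (3 * y + 1) + z * (3 * z + 1)
                                 + w * (3 * w + 1) = 2 * int m}"

lemma pent_quads_subset:
  "pent_quads m \<subseteq> {- int m..int m} \<times> {- int m..int m} \<times> {- int m..int m} \<times> {- int m..int m}"
proof
  fix q assume "q \<in> pent_quads m"
  then obtain x y z w where q: "q = (x, y, z, w)" and
    *: "x * (3 * x + 1) + y * (3 * y + 1) + z * (3 * z + 1) + w * (3 * w + 1) = 2 * int m"
    by (auto simp: pent_quads_def)
  have "2 * \<bar>k\<bar> \<le> k * (3 * k + 1)" for k :: int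
  proof (cases "k = 0")
    case False
    then have "\<bar>k\<bar> * 2 \<le> \<bar>k\<bar> * \<bar>3 * k + 1\<bar>" by (intro mult_left_mono) auto
    then show ?thesis using pentagonal_exponent_nonneg[of k] by (simp add: abs_mult[symmetric])
  qed simp
  from this[of x] this[of y] this[of z] this[of w] *
  have "\<bar>x\<bar> \<le> int m" "\<bar>y\<bar> \<le> int m" "\<bar>z\<bar> \<le> int m" "\<bar>w\<bar> \<le> int m" by linarith+
  then show "q \<in> {- int m..int m} \<times> {- int m..int m} \<times> {- int m..int m} \<times> {- int m..int m}"
    by (auto simp: q)
qed

lemma finite_pent_quads: "finite (pent_quads m)"
  by (rule finite_subset[OF pent_quads_subset]) auto

text \<open>The leading \<open>fps_X\<close> shifts the index to \<open>6 * m\<close>. Up to that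
  order the infinite product is a finite one, whose Euler product may be replaced by its pentagonal
  sum; the fourth power is then expanded.\<close>

lemma c_coeff_pent_quads:
  "c_coeff (6 * m + 1) = (\<Sum>(x, y, z, w)\<in>pent_quads m. parity_sign (x + y + z + w))"
proof -
  let ?P = "\<Prod>k. (1 - fps_X ^ (6 * Suc k)) ^ 4 :: int fps"
  have "(\<lambda>n. \<Prod>k<n. (1 - fps_X ^ (6 * Suc k)) ^ 4 :: int fps) \<longlonglongrightarrow> ?P"
    by (rule has_prod_imp_tendsto'[OF has_prod_eta_factors])
  then have "\<forall>\<^sub>F n in sequentially.
      fps_nth (\<Prod>k<n. (1 - fps_X ^ (6 * Suc k)) ^ 4) (6 * m) = fps_nth ?P (6 * m)"
    unfolding tendsto_fps_iff by blast
  \<comment> \<open>The bound \<open>n \<ge> m\<close> puts \<open>6 * m\<close> below the error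
    order \<open>6 * n + 6\<close> and \<open>pent_quads m\<close> inside the box
    \<open>?B\<close>.\<close>
  then obtain n where n: "n \<ge> m"
      "fps_nth (\<Prod>k<n. (1 - fps_X ^ (6 * Suc k)) ^ 4) (6 * m) = fps_nth ?P (6 * m)"
    unfolding eventually_sequentially by (metis nle_le)
  let ?I = "{- int n..int n}"
  \<comment> \<open>The product runs over powers of \<open>fps_X ^ 6\<close>, whose square root
    plays the role of \<open>r\<close> in Shanks' identity.\<close>
  define r where "r = (fps_X ^ 3 :: int fps)"
  define e where "e = (\<lambda>k. 3 * nat (k * (3 * k + 1)))"
  define W where "W = (\<Sum>k\<in>?I. parity_sign k * r ^ nat (k * (3 * k + 1)))"
  define P where "P = (\<Prod>k\<in>{1..n}. 1 - r ^ (2 * k))"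
  have "P = (\<Prod>k<n. 1 - fps_X ^ (6 * Suc k))"
    unfolding P_def r_def
    by (rule prod.reindex_bij_witness[where i = Suc and j = "\<lambda>k. k - 1"])
       (auto simp flip: power_mult)
  then have P4: "P ^ 4 = (\<Prod>k<n. (1 - fps_X ^ (6 * Suc k)) ^ 4)"
    by (simp add: prod_power_distrib)
  have "W - P dvd W ^ 4 - P ^ 4"
  proof
    show "W ^ 4 - P ^ 4 = (W - P) * ((W + P) * (W\<^sup>2 + P\<^sup>2))" by algebra
  qed
  with euler_product_cong[of r n] have "r ^ (2 * n + 2) dvd W ^ 4 - P ^ 4"
    unfolding W_def P_def by (rule dvd_trans)
  then obtain R where "W ^ 4 - P ^ 4 = r ^ (2 * n + 2) * R" by (elim dvdE)
  moreover have "r ^ (2 * n + 2) = fps_X ^ (6 * n + 6)"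
    unfolding r_def power_mult[symmetric] by (simp add: algebra_simps)
  ultimately have "W ^ 4 - P ^ 4 = fps_X ^ (6 * n + 6) * R" by simp
  then have "fps_nth (W ^ 4 - P ^ 4) (6 * m) = 0"
    using n(1) by (simp only: fps_X_power_mult_nth) simp
  then have WP: "fps_nth (W ^ 4) (6 * m) = fps_nth (P ^ 4) (6 * m)" by simp
  let ?B = "?I \<times> ?I \<times> ?I \<times> ?I"
  have W: "W = (\<Sum>k\<in>?I. fps_const (parity_sign k) * fps_X ^ e k)"
    unfolding W_def r_def e_def
    by (intro sum.cong refl) (simp add: parity_sign_def flip: power_mult fps_const_neg)
  have "W ^ 4 = W * (W * (W * W))" by (simp add: numeral_eq_Suc)
  also have "\<dots> = (\<Sum>(x, y, z, w)\<in>?B.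
      fps_const (parity_sign (x + y + z + w)) * fps_X ^ (e x + e y + e z + e w))"
    unfolding W sum_product sum.cartesian_product
    by (intro sum.cong refl) (auto simp: parity_sign_def power_add algebra_simps)
  finally have "fps_nth (W ^ 4) (6 * m) = (\<Sum>(x, y, z, w)\<in>?B.
      if 6 * m = e x + e y + e z + e w then parity_sign (x + y + z + w) else 0)"
    by (simp add: fps_sum_nth case_prod_unfold) (intro sum.cong refl, auto)
  also have "\<dots> = (\<Sum>(x, y, z, w)\<in>pent_quads m. parity_sign (x + y + z + w))"
  proof (rule sum.mono_neutral_cong_right)
    have e: "6 * m = e x + e y + e z + e w \<longleftrightarrow> (x, y, z, w) \<in> pent_quads m" for x y z w
    proof -
      have "6 * m = e x + e y + e z + e w \<longleftrightarrow> int (6 * m) = int (e x + e y + e z + e w)"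
        by (simp only: of_nat_eq_iff)
      also have "int (e x + e y + e z + e w) =
          3 * (x * (3 * x + 1) + y * (3 * y + 1) + z * (3 * z + 1) + w * (3 * w + 1))"
        unfolding e_def using pentagonal_exponent_nonneg by simp
      finally show ?thesis by (auto simp: pent_quads_def)
    qed
    show "finite ?B" by simp
    have "{- int m..int m} \<subseteq> ?I" using n(1) by auto
    then show "pent_quads m \<subseteq> ?B" using pent_quads_subset[of m] by blast
    show "\<forall>q\<in>?B - pent_quads m. (case q of (x, y, z, w) \<Rightarrow>
        if 6 * m = e x + e y + e z + e w then parity_sign (x + y + z + w) else 0) = (0 :: int)"
      by (auto simp: e)
    show "(case q of (x, y, z, w) \<Rightarrow>
        if 6 * m = e x + e y + e z + e w then parity_sign (x + y + z + w) else 0) =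
        (case q of (x, y, z, w) \<Rightarrow> (parity_sign (x + y + z + w) :: int))" if "q \<in> pent_quads m" for q
      using that by (cases q) (auto simp: e)
  qed
  finally show ?thesis
    using WP P4 n(2) by (simp add: c_coeff_def)
qed

section \<open>Representations with coefficients 1, 9, 9, 9\<close>

lemma card_eq_if_inverse:
  assumes "\<And>x. x \<in> A \<Longrightarrow> f x \<in> B \<and> g (f x) = x"
    and "\<And>y. y \<in> B \<Longrightarrow> g y \<in> A \<and> f (g y) = y"
  shows "card A = card B"
proof -
  have "bij_betw f A B"
    by (rule bij_betw_byWitness[where f' = g]) (use assms in auto)
  then show ?thesis by (rule bij_betw_same_card)
qed

definition nine_quads :: "int \<Rightarrow> (int \<times> int \<times> int \<times> int) set" where
  "nine_quads N = {(x, y, z, w). odd x \<and> odd y \<and> odd z \<and> odd w \<and>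
                                 x\<^sup>2 + 9 * y\<^sup>2 + 9 * z\<^sup>2 + 9 * w\<^sup>2 = N}"

lemma square_2x_minus_1: "(2 * x - 1)\<^sup>2 = 8 * triangular x + 1"
proof -
  have "even (x * (x - 1))" by simp
  then have "2 * triangular x = x * (x - 1)" by (simp add: triangular_def)
  then show ?thesis by (simp add: power2_eq_square algebra_simps)
qed

text \<open>Multiply by 8 and substitute \<open>2 * x - 1\<close> for each variable; the constants
  add up to 1 + 9 + 9 + 9 = 28.\<close>

lemma tri_reps_nine_quads: "tri_reps 1 9 9 9 n = card (nine_quads (4 * (2 * int n + 7)))"
proof -
  let ?A = "{(x, y, z, w). int n = int 1 * triangular x + int 9 * triangular y
                                    + int 9 * triangular z + int 9 * triangular w}"
  have "bij_betw (\<lambda>(x, y, z, w). (2 * x - 1, 2 * y - 1, 2 * z - 1, 2 * w - 1)) ?A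
          (nine_quads (4 * (2 * int n + 7)))"
  proof (rule bij_betw_byWitness
      [where f' = "\<lambda>(x, y, z, w). ((x + 1) div 2, (y + 1) div 2, (z + 1) div 2, (w + 1) div 2)"])
    show "(\<lambda>(x, y, z, w). ((x + 1) div 2, (y + 1) div 2, (z + 1) div 2, (w + 1) div 2)) `
        nine_quads (4 * (2 * int n + 7)) \<subseteq> ?A"
    proof (rule image_subsetI)
      fix q assume "q \<in> nine_quads (4 * (2 * int n + 7))"
      then obtain x y z w where q: "q = (x, y, z, w)" and
        *: "odd x" "odd y" "odd z" "odd w" "x\<^sup>2 + 9 * y\<^sup>2 + 9 * z\<^sup>2 + 9 * w\<^sup>2 = 4 * (2 * int n + 7)"
        by (auto simp: nine_quads_def)
      have "k\<^sup>2 = 8 * triangular ((k + 1) div 2) + 1" if "odd k" for k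
      proof -
        from that obtain j where "k = 2 * j + 1" by (elim oddE)
        then show ?thesis using square_2x_minus_1[of "j + 1"] by (simp add: algebra_simps)
      qed
      with * show "(case q of (x, y, z, w) \<Rightarrow>
          ((x + 1) div 2, (y + 1) div 2, (z + 1) div 2, (w + 1) div 2)) \<in> ?A"
        by (simp add: q)
    qed
    have "1 + 2 * (k div 2) = k" if "odd k" for k :: int
      using that by presburger
    then show "\<forall>q\<in>nine_quads (4 * (2 * int n + 7)).
        (case case q of (x, y, z, w) \<Rightarrow> ((x + 1) div 2, (y + 1) div 2, (z + 1) div 2, (w + 1) div 2) of
          (x, y, z, w) \<Rightarrow> (2 * x - 1, 2 * y - 1, 2 * z - 1, 2 * w - 1)) = q"
      by (auto simp: nine_quads_def)
  qed (auto simp: nine_quads_def square_2x_minus_1)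
  then show ?thesis by (simp add: tri_reps_def bij_betw_same_card)
qed

lemma square_mod_3: "x\<^sup>2 mod 3 = (if 3 dvd x then 0 else 1 :: int)"
proof -
  have "x mod 3 = 0 \<or> x mod 3 = 1 \<or> x mod 3 = 2" by presburger
  then show ?thesis by (auto simp: power_mod[of x 3 2, symmetric] dvd_eq_mod_eq_0)
qed

lemma nine_quads_mod_3:
  assumes "(x, y, z, w) \<in> nine_quads N"
  shows "N mod 3 = (if 3 dvd x then 0 else 1)"
proof -
  have "x\<^sup>2 mod 3 = N mod 3"
    using assms by (auto simp: nine_quads_def) presburger
  then show ?thesis by (simp add: square_mod_3)
qed

text \<open>The equation forces 3 to divide \<open>x\<close>; then 9 cancels.\<close>

lemma nine_quads_9: "card (nine_quads (9 * N)) = card (odd_quads N)"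
proof -
  have "bij_betw (\<lambda>(x, y, z, w). (3 * x, y, z, w)) (odd_quads N) (nine_quads (9 * N))"
  proof (rule bij_betw_byWitness[where f' = "\<lambda>(x, y, z, w). (x div 3, y, z, w)"])
    have "3 dvd x" if "(x, y, z, w) \<in> nine_quads (9 * N)" for x y z w
      using nine_quads_mod_3[OF that] by (auto split: if_splits)
    then show "\<forall>q\<in>nine_quads (9 * N). (case case q of (x, y, z, w) \<Rightarrow> (x div 3, y, z, w) of
        (x, y, z, w) \<Rightarrow> (3 * x, y, z, w)) = q"
      and "(\<lambda>(x, y, z, w). (x div 3, y, z, w)) ` nine_quads (9 * N) \<subseteq> odd_quads N"
      by (fastforce simp: nine_quads_def odd_quads_def power2_eq_square elim!: dvdE)+
  qed (auto simp: nine_quads_def odd_quads_def power2_eq_square)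
  then show ?thesis by (simp add: bij_betw_same_card)
qed

text \<open>\<open>N\<close> is congruent to \<open>x\<^sup>2\<close> modulo 9, and the squares
  modulo 9 are 0, 1, 4 and 7.\<close>

lemma nine_quads_empty:
  assumes "N mod 9 \<in> {2, 3, 5, 6, 8}"
  shows "nine_quads N = {}"
proof -
  have False if q: "(x, y, z, w) \<in> nine_quads N" for x y z w
  proof (cases "3 dvd x")
    case True
    then have "9 dvd x\<^sup>2" using dvd_power_same[of 3 x 2] by simp
    then have "9 dvd x\<^sup>2 + 9 * y\<^sup>2 + 9 * z\<^sup>2 + 9 * w\<^sup>2" by simp
    then have "9 dvd N" using q by (simp add: nine_quads_def)
    then show False using assms by auto
  next
    case False
    then have "N mod 3 = 1" using nine_quads_mod_3[OF q] by simp
    then show False using assms by simp presburger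
  qed
  then show ?thesis by auto
qed

section \<open>Odd numbers prime to 3 as signed values of \<open>6 * a + 1\<close>\<close>

definition unit_sign :: "int \<Rightarrow> int" where
  "unit_sign x = (if x mod 3 = 1 then 1 else -1)"

text \<open>For odd \<open>x\<close> prime to 3, \<open>unit_sign x * x\<close> is 1 modulo 6, so
  \<open>x\<close> determines the sign and the \<open>a\<close> with
  \<open>x = unit_sign x * (6 * a + 1)\<close>.\<close>

definition six_quot :: "int \<Rightarrow> int" where
  "six_quot x = (unit_sign x * x - 1) div 6"

lemma unit_sign_in: "unit_sign x \<in> {1, -1}"
  by (simp add: unit_sign_def)

lemma unit_sign_mult:
  assumes "s \<in> {1, -1}" "x mod 3 = 1"
  shows "unit_sign (s * x) = s"
  using assms by (auto simp: unit_sign_def) presburger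

lemma six_quot_mult:
  assumes "s \<in> {1, -1}"
  shows "six_quot (s * (6 * a + 1)) = a"
proof -
  have "(6 * a + 1) mod 3 = 1" by presburger
  then have "unit_sign (s * (6 * a + 1)) = s" by (rule unit_sign_mult[OF assms])
  then show ?thesis using assms by (auto simp: six_quot_def)
qed

lemma unit_sign_six_quot:
  assumes "odd x" "\<not> 3 dvd x"
  shows "unit_sign x * (6 * six_quot x + 1) = x"
proof (cases "x mod 3 = 1")
  case True
  then show ?thesis using assms by (simp add: unit_sign_def six_quot_def) presburger
next
  case False
  then show ?thesis using assms by (simp add: unit_sign_def six_quot_def) presburger
qed

text \<open>\<open>(6 * k + 1)\<^sup>2 = 12 * (k * (3 * k + 1)) + 1\<close>.\<close>

lemma sum_squares_6_plus_1:
  "(6 * a + 1)\<^sup>2 + (6 * b + 1)\<^sup>2 + (6 * c + 1)\<^sup>2 + (6 * d + 1)\<^sup>2 = 4 * int (6 * m + 1) \<longleftrightarrow>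
   (a, b, c, d) \<in> pent_quads m"
  by (auto simp: pent_quads_def power2_eq_square algebra_simps)

text \<open>Each of the four entries carries an independent sign, whence the factor 16.\<close>

lemma card_odd_quads_coprime_3:
  "card {(x, y, z, w) \<in> odd_quads (4 * int (6 * m + 1)). \<not> 3 dvd x \<and> \<not> 3 dvd y \<and> \<not> 3 dvd z \<and> \<not> 3 dvd w}
   = 16 * card (pent_quads m)" (is "card ?A = _")
proof -
  let ?U = "{1, -1 :: int}"
  let ?f = "\<lambda>((s, t, u, v), (a, b, c, d)). (s * (6 * a + 1), t * (6 * b + 1), u * (6 * c + 1), v * (6 * d + 1))"
  let ?g = "\<lambda>(x, y, z, w). ((unit_sign x, unit_sign y, unit_sign z, unit_sign w),
                                (six_quot x, six_quot y, six_quot z, six_quot w))"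
  have 1: "odd (s * (6 * a + 1))" "\<not> 3 dvd s * (6 * a + 1)" "(s * (6 * a + 1))\<^sup>2 = (6 * a + 1)\<^sup>2"
      "unit_sign (s * (6 * a + 1)) = s" if "s \<in> ?U" for s a
  proof -
    have "(6 * a + 1) mod 3 = 1" "\<not> 3 dvd 6 * a + 1" by presburger+
    then show "unit_sign (s * (6 * a + 1)) = s" by (intro unit_sign_mult that)
    show "\<not> 3 dvd s * (6 * a + 1)"
      using that \<open>\<not> 3 dvd 6 * a + 1\<close> dvd_minus_iff[of 3 "6 * a + 1"]
      by (elim insertE emptyE) (simp_all only: mult_1 mult_minus1 not_False_eq_True)
    show "odd (s * (6 * a + 1))" using that by auto
    show "(s * (6 * a + 1))\<^sup>2 = (6 * a + 1)\<^sup>2" using that by (auto simp: power_mult_distrib)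
  qed
  have 2: "x\<^sup>2 = (6 * six_quot x + 1)\<^sup>2" if "odd x" "\<not> 3 dvd x" for x
    using 1(3)[OF unit_sign_in, of x "six_quot x"] unit_sign_six_quot[OF that] by simp
  have f: "?f p \<in> ?A \<and> ?g (?f p) = p" if "p \<in> (?U \<times> ?U \<times> ?U \<times> ?U) \<times> pent_quads m" for p
  proof -
    obtain s t u v a b c d where p: "p = ((s, t, u, v), (a, b, c, d))"
      "s \<in> ?U" "t \<in> ?U" "u \<in> ?U" "v \<in> ?U" "(a, b, c, d) \<in> pent_quads m"
      using \<open>p \<in> _\<close> by (cases p) auto
    note sq = 1(3)[OF p(2), of a] 1(3)[OF p(3), of b] 1(3)[OF p(4), of c] 1(3)[OF p(5), of d]
    have "?f p \<in> ?A"
      unfolding p(1) odd_quads_def mem_Collect_eq split_conv sq sum_squares_6_plus_1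
      using p 1(1,2) by blast
    moreover have "?g (?f p) = p"
      using p(2-5) by (simp only: p(1) split_conv 1(4) six_quot_mult)
    ultimately show ?thesis by blast
  qed
  have g: "?g q \<in> (?U \<times> ?U \<times> ?U \<times> ?U) \<times> pent_quads m \<and> ?f (?g q) = q" if "q \<in> ?A" for q
  proof -
    obtain x y z w where q: "q = (x, y, z, w)" "odd x" "odd y" "odd z" "odd w"
      "\<not> 3 dvd x" "\<not> 3 dvd y" "\<not> 3 dvd z" "\<not> 3 dvd w"
      "x\<^sup>2 + y\<^sup>2 + z\<^sup>2 + w\<^sup>2 = 4 * int (6 * m + 1)"
      using \<open>q \<in> ?A\<close> by (auto simp: odd_quads_def)
    have "(six_quot x, six_quot y, six_quot z, six_quot w) \<in> pent_quads m"
      using q(10) unfolding sum_squares_6_plus_1[symmetric]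
      by (simp only: 2[OF q(2,6), symmetric] 2[OF q(3,7), symmetric]
          2[OF q(4,8), symmetric] 2[OF q(5,9), symmetric])
    then have "?g q \<in> (?U \<times> ?U \<times> ?U \<times> ?U) \<times> pent_quads m"
      unfolding q(1) split_conv by (intro SigmaI unit_sign_in)
    moreover have "?f (?g q) = q"
      by (simp only: q(1) split_conv unit_sign_six_quot[OF q(2,6)] unit_sign_six_quot[OF q(3,7)]
          unit_sign_six_quot[OF q(4,8)] unit_sign_six_quot[OF q(5,9)])
    ultimately show ?thesis by (rule conjI)
  qed
  have "card ?A = card ((?U \<times> ?U \<times> ?U \<times> ?U) \<times> pent_quads m)"
    by (rule card_eq_if_inverse[where f = ?g and g = ?f, OF g f])
  then show ?thesis by (simp add: card_cartesian_product)
qed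

text \<open>Squares are 0 or 1 modulo 3 and the sum is 1 modulo 3, so one or all four entries are
  prime to 3. The four positions of a single such entry are equivalent, and dividing the other
  entries by 3 gives \<open>nine_quads\<close>.\<close>

lemma card_odd_quads_nine_quads:
  "card (odd_quads (4 * int (6 * m + 1))) =
     4 * card (nine_quads (4 * int (6 * m + 1))) + 16 * card (pent_quads m)"
proof -
  define N where "N = 4 * int (6 * m + 1)"
  have N3: "N mod 3 = 1" by (simp add: N_def) presburger
  define A where "A = {(x, y, z, w) \<in> odd_quads N. \<not> 3 dvd x \<and> \<not> 3 dvd y \<and> \<not> 3 dvd z \<and> \<not> 3 dvd w}"
  define B1 where "B1 = {(x, y, z, w) \<in> odd_quads N. \<not> 3 dvd x \<and> 3 dvd y \<and> 3 dvd z \<and> 3 dvd w}"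
  define B2 where "B2 = {(x, y, z, w) \<in> odd_quads N. 3 dvd x \<and> \<not> 3 dvd y \<and> 3 dvd z \<and> 3 dvd w}"
  define B3 where "B3 = {(x, y, z, w) \<in> odd_quads N. 3 dvd x \<and> 3 dvd y \<and> \<not> 3 dvd z \<and> 3 dvd w}"
  define B4 where "B4 = {(x, y, z, w) \<in> odd_quads N. 3 dvd x \<and> 3 dvd y \<and> 3 dvd z \<and> \<not> 3 dvd w}"
  have cases: "q \<in> A \<union> (B1 \<union> (B2 \<union> (B3 \<union> B4)))" if "q \<in> odd_quads N" for q
  proof -
    obtain x y z w where q: "q = (x, y, z, w)" by (cases q) auto
    have "x\<^sup>2 + y\<^sup>2 + z\<^sup>2 + w\<^sup>2 = N" using that by (simp add: q odd_quads_def)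
    then have "(x\<^sup>2 mod 3 + y\<^sup>2 mod 3 + z\<^sup>2 mod 3 + w\<^sup>2 mod 3) mod 3 = 1"
      using N3 by presburger
    then show ?thesis
      using that unfolding q A_def B1_def B2_def B3_def B4_def
      by (simp add: square_mod_3 split: if_splits)
  qed
  have eq: "odd_quads N = A \<union> (B1 \<union> (B2 \<union> (B3 \<union> B4)))"
  proof
    show "A \<union> (B1 \<union> (B2 \<union> (B3 \<union> B4))) \<subseteq> odd_quads N"
      by (auto simp: A_def B1_def B2_def B3_def B4_def)
  qed (use cases in blast)
  have fin: "finite A" "finite B1" "finite B2" "finite B3" "finite B4"
    using finite_odd_quads[of N] unfolding eq by auto
  have "A \<inter> (B1 \<union> (B2 \<union> (B3 \<union> B4))) = {}" "B1 \<inter> (B2 \<union> (B3 \<union> B4)) = {}"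
    "B2 \<inter> (B3 \<union> B4) = {}" "B3 \<inter> B4 = {}"
    unfolding A_def B1_def B2_def B3_def B4_def by auto
  then have card: "card (odd_quads N) = card A + card B1 + card B2 + card B3 + card B4"
    using fin by (simp add: eq card_Un_disjoint)
  have "card B2 = card B1"
    by (rule bij_betw_same_card[where f = "\<lambda>(x, y, z, w). (y, x, z, w)"],
        rule bij_betw_byWitness[where f' = "\<lambda>(x, y, z, w). (y, x, z, w)"])
       (auto simp: B1_def B2_def odd_quads_def)
  moreover have "card B3 = card B1"
    by (rule bij_betw_same_card[where f = "\<lambda>(x, y, z, w). (z, y, x, w)"],
        rule bij_betw_byWitness[where f' = "\<lambda>(x, y, z, w). (z, y, x, w)"])
       (auto simp: B1_def B3_def odd_quads_def)
  moreover have "card B4 = card B1"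
    by (rule bij_betw_same_card[where f = "\<lambda>(x, y, z, w). (w, y, z, x)"],
        rule bij_betw_byWitness[where f' = "\<lambda>(x, y, z, w). (w, y, z, x)"])
       (auto simp: B1_def B4_def odd_quads_def)
  moreover have "card (nine_quads N) = card B1"
  proof (rule bij_betw_same_card[where f = "\<lambda>(x, y, z, w). (x, 3 * y, 3 * z, 3 * w)"],
      rule bij_betw_byWitness[where f' = "\<lambda>(x, y, z, w). (x, y div 3, z div 3, w div 3)"])
    have "\<not> 3 dvd x" if "(x, y, z, w) \<in> nine_quads N" for x y z w
      using nine_quads_mod_3[OF that] N3 by auto
    then show "(\<lambda>(x, y, z, w). (x, 3 * y, 3 * z, 3 * w)) ` nine_quads N \<subseteq> B1"
      by (auto simp: nine_quads_def B1_def odd_quads_def power_mult_distrib)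
    show "(\<lambda>(x, y, z, w). (x, y div 3, z div 3, w div 3)) ` B1 \<subseteq> nine_quads N"
      by (auto simp: nine_quads_def B1_def odd_quads_def power_mult_distrib elim!: dvdE)
  qed (auto simp: B1_def)
  moreover have "card A = 16 * card (pent_quads m)"
    unfolding A_def N_def by (rule card_odd_quads_coprime_3)
  ultimately show ?thesis using card by (simp add: N_def)
qed

text \<open>The involutory Hadamard transformation; the signs of \<open>x\<close> and \<open>w\<close> are fixed by requiring
  \<open>x \<equiv> 2 (mod 3)\<close> and \<open>k + y + z + w \<equiv> 0 (mod 4)\<close>.\<close>

lemma card_nine_quads:
  "card (nine_quads (4 * int (6 * m + 1))) = 4 * card {(a, b, c, d) \<in> pent_quads m. odd (a + b + c + d)}"
  (is "card ?T = 4 * card ?O")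
proof -
  let ?U = "{1, -1 :: int}"
  define f where "f = (\<lambda>(s::int, t::int, a::int, b::int, c::int, d::int).
    (s * (3 * (a + b + c + d) + 2), a + b - c - d, a - b + c - d, t * (a - b - c + d)))"
  define g where "g = (\<lambda>(x, y, z, w :: int).
    let s = - unit_sign x; k = (s * x - 2) div 3; t = (if 4 dvd k + y + z + w then 1 else -1); r = t * w
    in (s, t, (k + y + z + r) div 4, (k + y - z - r) div 4, (k - y + z - r) div 4, (k - y - z + r) div 4))"
  have f: "f p \<in> ?T \<and> g (f p) = p" if "p \<in> ?U \<times> ?U \<times> ?O" for p
  proof -
    obtain s t a b c d where p: "p = (s, t, a, b, c, d)" and st: "s \<in> ?U" "t \<in> ?U"
      and O: "(a, b, c, d) \<in> pent_quads m" "odd (a + b + c + d)"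
      using \<open>p \<in> _\<close> by (cases p) auto
    define k where "k = a + b + c + d"
    have s2: "s\<^sup>2 = 1" "t\<^sup>2 = 1" "s * (s * x) = x" "t * (t * x) = x" for x using st by auto
    \<comment> \<open>Half the Hadamard matrix is orthogonal: both sides equal the sum of the
      squares of \<open>6 * a + 1\<close> to \<open>6 * d + 1\<close>. All image entries have the
      parity of \<open>k\<close>, which is why only odd \<open>k\<close> enters.\<close>
    have "(3 * k + 2)\<^sup>2 + 9 * (a + b - c - d)\<^sup>2 + 9 * (a - b + c - d)\<^sup>2 + 9 * (a - b - c + d)\<^sup>2
        = 12 * (a * (3 * a + 1) + b * (3 * b + 1) + c * (3 * c + 1) + d * (3 * d + 1)) + 4"
      unfolding k_def by algebra
    then have "f p \<in> ?T"
      using O st by (auto simp: p f_def nine_quads_def pent_quads_def power_mult_distrib s2 k_def)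
    moreover have "g (f p) = p"
    proof -
      \<comment> \<open>The first image entry is \<open>s\<close> times a number that is 2 modulo 3,
        hence the minus sign before \<open>unit_sign\<close> in \<open>g\<close>.\<close>
      have "(- (3 * k + 2)) mod 3 = 1" by presburger
      then have "unit_sign ((- s) * (- (3 * k + 2))) = - s"
        using st by (intro unit_sign_mult) auto
      then have us: "- unit_sign (s * (3 * k + 2)) = s" unfolding minus_mult_minus by simp
      have k3: "(s * (s * (3 * k + 2)) - 2) div 3 = k" by (simp add: s2)
      have "k + (a + b - c - d) + (a - b + c - d) + (a - b - c + d) = 4 * a"
        by (simp add: k_def)
      \<comment> \<open>Flipping the sign of this odd entry changes the total by 2 modulo 4, so
        exactly one sign makes it divisible by 4.\<close>
      moreover have "odd (a - b - c + d)" using O(2) by presburger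
      ultimately have "4 dvd k + (a + b - c - d) + (a - b + c - d) + (a - b - c + d)"
          "\<not> 4 dvd k + (a + b - c - d) + (a - b + c - d) + - (a - b - c + d)"
        by presburger+
      with st(2) have t: "(if 4 dvd k + (a + b - c - d) + (a - b + c - d) + t * (a - b - c + d)
          then 1 else -1) = t"
        by (elim insertE emptyE) (simp_all only: mult_1 mult_minus1 if_True if_False)
      show ?thesis
        unfolding p f_def g_def split_conv k_def[symmetric] Let_def us k3 t by (simp add: s2) (simp add: k_def)
    qed
    ultimately show ?thesis by (rule conjI)
  qed
  have g: "g q \<in> ?U \<times> ?U \<times> ?O \<and> f (g q) = q" if "q \<in> ?T" for q
  proof -
    obtain x y z w where q: "q = (x, y, z, w)" and odd: "odd x" "odd y" "odd z" "odd w"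
      and sum: "x\<^sup>2 + 9 * y\<^sup>2 + 9 * z\<^sup>2 + 9 * w\<^sup>2 = 4 * int (6 * m + 1)"
      using \<open>q \<in> ?T\<close> by (auto simp: nine_quads_def)
    have "(4 * int (6 * m + 1)) mod 3 = 1" by simp presburger
    then have x3: "\<not> 3 dvd x" using nine_quads_mod_3 that q by fastforce
    define s where "s = - unit_sign x"
    define k where "k = (s * x - 2) div 3"
    define t where "t = (if 4 dvd k + y + z + w then 1 else -1 :: int)"
    define r where "r = t * w"
    have st: "s \<in> ?U" "t \<in> ?U" by (auto simp: s_def t_def unit_sign_def)
    have s2: "s * (s * v) = v" "t * (t * v) = v" for v using st by auto
    have "(s * x) mod 3 = 2" using x3 by (simp add: s_def unit_sign_def) presburger
    then have sx: "s * x = 3 * k + 2" unfolding k_def by presburger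
    moreover have "odd (s * x)" using odd(1) st by auto
    ultimately have "odd k" by simp
    have "odd r" using odd(4) st by (auto simp: r_def)
    \<comment> \<open>The sum \<open>k + y + z + w\<close> of four odd numbers is even; if it is 2
      modulo 4, replacing \<open>w\<close> by \<open>- w\<close> corrects it.\<close>
    have "4 dvd k + y + z + r"
      using \<open>odd k\<close> odd unfolding r_def t_def by auto presburger
    define a where "a = (k + y + z + r) div 4"
    define b where "b = (k + y - z - r) div 4"
    define c where "c = (k - y + z - r) div 4"
    define d where "d = (k - y - z + r) div 4"
    \<comment> \<open>The other three numerators differ from \<open>k + y + z + r\<close> by twice a
      sum of two odd numbers, so they are divisible by 4 as well.\<close>
    have abcd: "4 * a = k + y + z + r" "4 * b = k + y - z - r" "4 * c = k - y + z - r" "4 * d = k - y - z + r"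
      using \<open>4 dvd k + y + z + r\<close> \<open>odd k\<close> \<open>odd r\<close> odd unfolding a_def b_def c_def d_def by presburger+
    have gq: "g q = (s, t, a, b, c, d)"
      by (simp add: q g_def Let_def a_def b_def c_def d_def r_def t_def k_def s_def)
    have lin: "a + b + c + d = k" "a + b - c - d = y" "a - b + c - d = z" "a - b - c + d = r"
      using abcd by linarith+
    have fq: "f (s, t, a, b, c, d) = q"
      unfolding f_def split_conv lin sx[symmetric] s2 r_def q ..
    have "(a, b, c, d) \<in> pent_quads m"
    proof -
      have "(s * x)\<^sup>2 = x\<^sup>2" "r\<^sup>2 = w\<^sup>2" using st by (auto simp: r_def power_mult_distrib)
      then have "(3 * k + 2)\<^sup>2 + 9 * y\<^sup>2 + 9 * z\<^sup>2 + 9 * r\<^sup>2 = 4 * int (6 * m + 1)"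
        using sum by (simp add: sx)
      moreover have "(3 * k + 2)\<^sup>2 + 9 * y\<^sup>2 + 9 * z\<^sup>2 + 9 * r\<^sup>2
        = 12 * (a * (3 * a + 1) + b * (3 * b + 1) + c * (3 * c + 1) + d * (3 * d + 1)) + 4"
        unfolding lin[symmetric] by algebra
      ultimately show ?thesis by (simp add: pent_quads_def)
    qed
    then have "(a, b, c, d) \<in> ?O"
      unfolding mem_Collect_eq split_conv lin(1) using \<open>odd k\<close> by blast
    then have "g q \<in> ?U \<times> ?U \<times> ?O" unfolding gq using st by (intro SigmaI)
    moreover have "f (g q) = q" unfolding gq by (rule fq)
    ultimately show ?thesis by (rule conjI)
  qed
  have "card ?T = card (?U \<times> ?U \<times> ?O)"
    by (rule card_eq_if_inverse[OF g f])
  then show ?thesis by (simp add: card_cartesian_product)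
qed

lemma card_nine_quads_c_coeff:
  "3 * int (card (nine_quads (4 * int (6 * m + 1)))) =
     4 * (int (divisor_sum (6 * m + 1)) - c_coeff (6 * m + 1))"
proof -
  let ?V = "pent_quads m"
  let ?O = "{(a, b, c, d) \<in> ?V. odd (a + b + c + d)}"
  let ?E = "{(a, b, c, d) \<in> ?V. even (a + b + c + d)}"
  have V: "?V = ?E \<union> ?O" "?E \<inter> ?O = {}" by auto
  have fin: "finite ?E" "finite ?O"
    using finite_pent_quads[of m] by (auto elim: rev_finite_subset)
  have "c_coeff (6 * m + 1) = (\<Sum>(a, b, c, d)\<in>?E \<union> ?O. parity_sign (a + b + c + d))"
    unfolding c_coeff_pent_quads V(1)[symmetric] ..
  also have "\<dots> = (\<Sum>(a, b, c, d)\<in>?E. parity_sign (a + b + c + d)) +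
                      (\<Sum>(a, b, c, d)\<in>?O. parity_sign (a + b + c + d))"
    by (rule sum.union_disjoint[OF fin V(2)])
  also have "\<dots> = (\<Sum>q\<in>?E. 1) + (\<Sum>q\<in>?O. - 1)"
    by (intro arg_cong2[where f = "(+)"] sum.cong) (auto simp: parity_sign_def split: if_splits)
  finally have c: "c_coeff (6 * m + 1) = int (card ?E) - int (card ?O)" by simp
  have "card ?V = card ?E + card ?O"
    using card_Un_disjoint[OF fin V(2)] V(1) by simp
  moreover have "card (odd_quads (4 * int (6 * m + 1))) = 16 * divisor_sum (6 * m + 1)"
    by (rule card_odd_quads) simp
  \<comment> \<open>16 times the right side is
    \<open>4 * (4 * card ?O) + 16 * (card ?E + card ?O)\<close>. Subtracting \<open>c_coeff\<close>
    then leaves \<open>3 * card ?O\<close>, three quarters of the wanted count.\<close>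
  ultimately have "divisor_sum (6 * m + 1) = card ?E + 2 * card ?O"
    using card_odd_quads_nine_quads[of m] card_nine_quads[of m] by linarith
  then show ?thesis
    using c card_nine_quads[of m] by simp
qed

theorem theorem4p3:
  fixes n :: nat
  assumes "n > 0"
  shows "(n mod 9 = 1 \<longrightarrow> tri_reps 1 9 9 9 n = 16 * divisor_sum ((2 * n + 7) div 9)) \<and>
         (n mod 9 \<in> {2, 4, 5, 7, 8} \<longrightarrow> tri_reps 1 9 9 9 n = 0) \<and>
         (n mod 3 = 0 \<longrightarrow>
            real (tri_reps 1 9 9 9 n)
              = 4 / 3 * (real (divisor_sum (2 * n + 7)) - real_of_int (c_coeff (2 * n + 7))))"
proof (intro conjI impI)
  assume "n mod 9 = 1"
  define k where "k = (2 * n + 7) div 9"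
  have k: "2 * n + 7 = 9 * k" "odd k"
    using \<open>n mod 9 = 1\<close> unfolding k_def by presburger+
  have "4 * (2 * int n + 7) = 9 * (4 * int k)" using k(1) by presburger
  then show "tri_reps 1 9 9 9 n = 16 * divisor_sum ((2 * n + 7) div 9)"
    using k by (simp only: tri_reps_nine_quads nine_quads_9 card_odd_quads[OF k(2)]) simp
next
  assume "n mod 9 \<in> {2, 4, 5, 7, 8}"
  \<comment> \<open>The number \<open>8 * n + 28\<close> is congruent to \<open>1 - n\<close> modulo
    9.\<close>
  then have "(4 * (2 * int n + 7)) mod 9 \<in> {2, 3, 5, 6, 8}" by auto presburger+
  then show "tri_reps 1 9 9 9 n = 0"
    by (simp only: tri_reps_nine_quads nine_quads_empty card.empty)
next
  assume "n mod 3 = 0"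
  define m where "m = (2 * n + 6) div 6"
  have m: "2 * n + 7 = 6 * m + 1"
    using \<open>n mod 3 = 0\<close> unfolding m_def by presburger
  then have "2 * int n + 7 = int (6 * m + 1)" by presburger
  then have "3 * int (tri_reps 1 9 9 9 n) =
      4 * (int (divisor_sum (2 * n + 7)) - c_coeff (2 * n + 7))"
    by (simp only: tri_reps_nine_quads m card_nine_quads_c_coeff)
  then have "real_of_int (3 * int (tri_reps 1 9 9 9 n)) =
      real_of_int (4 * (int (divisor_sum (2 * n + 7)) - c_coeff (2 * n + 7)))"
    by (rule arg_cong)
  then show "real (tri_reps 1 9 9 9 n)
      = 4 / 3 * (real (divisor_sum (2 * n + 7)) - real_of_int (c_coeff (2 * n + 7)))"
    by simp
qed

end
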